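(* Let $(A,\mathbf{T},\alpha)$ be a C*-dynamical system with $sp(\alpha)=\{-n_0,0,n_0\}$ for some positive integer $n_0$, such that the ideal $I=\overline{A_{n_0}A_{-n_0}}$ of $A^{\alpha}$ is a simple C*-algebra. Let $J=\overline{A_{-n_0}A_{n_0}}$ and $B=\overline{(I+J)A(I+J)}$. Then $B$ is a simple C*-algebra.
   Context: $\mathbf{T}=\{z\in\mathbf{C}: |z|=1\}$. A C*-dynamical system $(A,\mathbf{T},\alpha)$ consists of a C*-algebra $A$ (not assumed unital) and a homomorphism $\alpha:\mathbf{T}\to \mathrm{Aut}(A)$ such that $z\mapsto\alpha_z(x)$ is norm-continuous for every $x\in A$. For $n\in\mathbf{Z}$ put $A_n=\{x\in A: \alpha_z(x)=z^n x \text{ for all } z\in\mathbf{T}\}$; $A^{\alpha}=A_0$ is the fixed point algebra. The Arveson spectrum is $sp(\alpha)=\{n\in\mathbf{Z}: A_n\neq\{0\}\}$. Products of subspaces denote the set of finite sums of products of elements, and the bar denotes norm closure; $I$ and $J$ are closed two-sided ideals of $A^{\alpha}$, and $B$ is an $\alpha$-invariant hereditary C*-subalgebra of $A$. *)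

theory Defs
  imports "HOL-Analysis.Analysis" "HOL-Library.Set_Algebras"
begin

text \<open>
  C*-algebras, not necessarily unital and possibly zero. The library has no complex vector
  space class, so the complex scalar multiplication \<open>cscale\<close> is a class parameter.
  Submultiplicativity of the norm comes from \<open>real_normed_algebra\<close>, completeness from
  \<open>banach\<close>.
\<close>

class cstar_algebra = real_normed_algebra + banach +
  fixes cscale :: "complex \<Rightarrow> 'a \<Rightarrow> 'a"
    and adj :: "'a \<Rightarrow> 'a"
  assumes cscale_add_right: "cscale c (x + y) = cscale c x + cscale c y"
    and cscale_add_left: "cscale (c + d) x = cscale c x + cscale d x"
    and cscale_cscale: "cscale c (cscale d x) = cscale (c * d) x"
    and cscale_of_real: "cscale (complex_of_real r) x = scaleR r x"
    and cscale_mult_left: "cscale c x * y = cscale c (x * y)"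
    and cscale_mult_right: "x * cscale c y = cscale c (x * y)"
    and norm_cscale: "norm (cscale c x) = cmod c * norm x"
    and adj_adj: "adj (adj x) = x"
    and adj_add: "adj (x + y) = adj x + adj y"
    and adj_cscale: "adj (cscale c x) = cscale (cnj c) (adj x)"
    and adj_mult: "adj (x * y) = adj y * adj x"
    and cstar_identity: "norm (adj x * x) = (norm x)\<^sup>2"

definition complex_subspace :: "'a::cstar_algebra set \<Rightarrow> bool" where
  "complex_subspace S \<longleftrightarrow>
     0 \<in> S \<and> (\<forall>x\<in>S. \<forall>y\<in>S. x + y \<in> S) \<and> (\<forall>c. \<forall>x\<in>S. cscale c x \<in> S)"

definition cstar_subalgebra :: "'a::cstar_algebra set \<Rightarrow> bool" where
  "cstar_subalgebra S \<longleftrightarrow>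
     complex_subspace S \<and> closed S \<and> (\<forall>x\<in>S. \<forall>y\<in>S. x * y \<in> S) \<and> (\<forall>x\<in>S. adj x \<in> S)"

definition closed_ideal_of :: "'a::cstar_algebra set \<Rightarrow> 'a set \<Rightarrow> bool" where
  "closed_ideal_of K S \<longleftrightarrow>
     K \<subseteq> S \<and> complex_subspace K \<and> closed K \<and>
     (\<forall>k\<in>K. \<forall>s\<in>S. s * k \<in> K \<and> k * s \<in> K)"

definition simple_cstar_algebra :: "'a::cstar_algebra set \<Rightarrow> bool" where
  "simple_cstar_algebra S \<longleftrightarrow>
     cstar_subalgebra S \<and> S \<noteq> {0} \<and> (\<forall>K. closed_ideal_of K S \<longrightarrow> K = {0} \<or> K = S)"

definition star_automorphism :: "('a::cstar_algebra \<Rightarrow> 'a) \<Rightarrow> bool" where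
  "star_automorphism f \<longleftrightarrow>
     bij f \<and> (\<forall>x y. f (x + y) = f x + f y) \<and> (\<forall>c x. f (cscale c x) = cscale c (f x)) \<and>
     (\<forall>x y. f (x * y) = f x * f y) \<and> (\<forall>x. f (adj x) = adj (f x))"

text \<open>
  An action of the circle group, which is \<open>sphere 0 1\<close> in the complex plane. The values of
  \<open>\<alpha>\<close> off the circle are unconstrained and never used.
\<close>

definition circle_action :: "(complex \<Rightarrow> 'a::cstar_algebra \<Rightarrow> 'a) \<Rightarrow> bool" where
  "circle_action \<alpha> \<longleftrightarrow>
     (\<forall>z\<in>sphere 0 1. star_automorphism (\<alpha> z)) \<and>
     (\<forall>z\<in>sphere 0 1. \<forall>w\<in>sphere 0 1. \<alpha> (z * w) = \<alpha> z \<circ> \<alpha> w) \<and>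
     (\<forall>x. continuous_on (sphere 0 1) (\<lambda>z. \<alpha> z x))"

definition spectral_subspace ::
    "(complex \<Rightarrow> 'a::cstar_algebra \<Rightarrow> 'a) \<Rightarrow> int \<Rightarrow> 'a set" where
  "spectral_subspace \<alpha> n = {x. \<forall>z\<in>sphere 0 1. \<alpha> z x = cscale (z powi n) x}"

definition arveson_spectrum :: "(complex \<Rightarrow> 'a::cstar_algebra \<Rightarrow> 'a) \<Rightarrow> int set" where
  "arveson_spectrum \<alpha> = {n. spectral_subspace \<alpha> n \<noteq> {0}}"

text \<open>
  The product of two subspaces consists of finite sums of products. It is not the elementwise
  product \<open>X * Y\<close> of \<open>Set_Algebras\<close>.
\<close>

definition subspace_product :: "'a::cstar_algebra set \<Rightarrow> 'a set \<Rightarrow> 'a set" where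
  "subspace_product X Y =
     {(\<Sum>i<m. x i * y i) | (m::nat) x y. \<forall>i<m. x i \<in> X \<and> y i \<in> Y}"

end

theory Submission imports Defs begin

text \<open>
  Write \<open>X\<close> and \<open>Y\<close> for the spectral subspaces of degrees \<open>n\<^sub>0\<close> and \<open>- n\<^sub>0\<close>, so that \<open>Y\<close> consists of
  the adjoints of \<open>X\<close>. The algebra \<open>A\<close> is the sum of its three nonzero spectral subspaces. Since
  \<open>2 * n\<^sub>0\<close> is outside the spectrum, \<open>X * X\<close> and \<open>Y * Y\<close> vanish, and in \<open>x * a * y\<close> only the component
  of \<open>a\<close> of degree zero survives: \<open>X * A * Y \<subseteq> I\<close>. Hence \<open>I\<close> is a hereditary corner of \<open>B\<close>, and \<open>X\<close>
  links it with \<open>J\<close>; the statement is the Morita principle that simplicity passes from a full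
  corner to the whole algebra.

  In detail, let \<open>K\<close> be a closed ideal of \<open>B\<close>. Then \<open>K \<inter> I\<close> is a closed ideal of \<open>I\<close>, so it is \<open>I\<close>
  or zero. If \<open>I \<subseteq> K\<close>, then \<open>K\<close> contains \<open>I * A * J\<close>, \<open>J * A * I\<close> and \<open>I * A * I\<close>, and also
  \<open>J * A * J\<close>, which is spanned by elements of \<open>Y * (X * A * Y) * X \<subseteq> Y * I * X\<close>; thus \<open>K = B\<close>
  (\<open>ideal_containing_I\<close>). If \<open>K \<inter> I\<close> is zero, then \<open>I * K * I\<close> and \<open>I * (X * K * Y) * I\<close>
  vanish, which by the C*-identity forces \<open>I * K\<close>, \<open>X * K * Y\<close>, \<open>J * K\<close> and finally \<open>B * K\<close> to
  vanish; since \<open>adj k * k \<in> B * K\<close>, the ideal is zero (\<open>ideal_disjoint_from_I\<close>).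
  The usual appeals to approximate units are replaced by the density of \<open>I * I\<close> in \<open>I\<close>, which
  follows from simplicity (\<open>I_eq_closure_II\<close>).

  The decomposition of \<open>A\<close> is Fourier analysis of the orbit \<open>z \<mapsto> \<alpha> z a\<close>: its Fourier coefficients
  lie in the spectral subspaces, and a continuous function all of whose Fourier coefficients vanish is
  zero (\<open>finite_spectral_decomposition\<close>). That the coefficients are spectral requires
  \<open>\<alpha> z\<close> to commute with integrals, hence to be bounded. This is the contractivity of
  *-automorphisms, proved here by writing a self-adjoint element of norm less than one as the real part
  of a unitary (\<open>star_automorphism_contractive\<close>).
\<close>

section \<open>Elementary C*-algebra\<close>

lemma bounded_bilinear_cscale: "bounded_bilinear (cscale :: complex \<Rightarrow> 'a::cstar_algebra \<Rightarrow> 'a)"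
proof
  show "\<exists>K. \<forall>a b. norm (cscale a b :: 'a) \<le> norm a * norm b * K"
    by (rule exI[of _ 1]) (simp add: norm_cscale)
  show "cscale (r *\<^sub>R c) (x::'a) = r *\<^sub>R cscale c x" for r c x
    by (simp add: cscale_cscale scaleR_conv_of_real flip: cscale_of_real)
  show "cscale c (r *\<^sub>R (x::'a)) = r *\<^sub>R cscale c x" for r c x
    unfolding cscale_of_real[symmetric] cscale_cscale by (simp add: mult.commute)
qed (rule cscale_add_left cscale_add_right)+

interpretation cscale: bounded_bilinear "cscale :: complex \<Rightarrow> 'a::cstar_algebra \<Rightarrow> 'a"
  by (rule bounded_bilinear_cscale)

lemma cscale_one [simp]: "cscale 1 (x::'a::cstar_algebra) = x"
  using cscale_of_real[of 1 x] by simp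

lemma cscale_eq_0_iff [simp]: "cscale c (x::'a::cstar_algebra) = 0 \<longleftrightarrow> c = 0 \<or> x = 0"
  by (metis norm_cscale norm_eq_zero mult_eq_0_iff)

lemma adj_scaleR: "adj (r *\<^sub>R x) = r *\<^sub>R adj (x::'a::cstar_algebra)"
  by (simp add: adj_cscale flip: cscale_of_real)

lemma adj_zero [simp]: "adj (0::'a::cstar_algebra) = 0"
  using adj_scaleR[of 0 "0::'a"] by simp

lemma adj_diff: "adj (x - y) = adj x - adj (y::'a::cstar_algebra)"
  by (metis adj_add add_diff_cancel diff_add_cancel)

lemma norm_adj [simp]: "norm (adj x) = norm (x::'a::cstar_algebra)"
proof -
  have le: "norm x \<le> norm (adj x)" for x :: 'a
  proof (cases "norm x = 0")
    case False
    have "norm x * norm x \<le> norm (adj x) * norm x"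
      using cstar_identity[of x] norm_mult_ineq[of "adj x" x] by (simp add: power2_eq_square)
    then show ?thesis using False by (simp add: mult_le_cancel_right)
  qed simp
  show ?thesis using le[of x] le[of "adj x"] by (simp add: adj_adj)
qed

lemma bounded_linear_adj: "bounded_linear (adj :: 'a::cstar_algebra \<Rightarrow> 'a)"
  by (rule bounded_linear_intro[where K = 1]) (auto simp: adj_add adj_scaleR)

lemma adj_mult_self_eq_0: "adj x * x = 0 \<Longrightarrow> x = (0::'a::cstar_algebra)"
  using cstar_identity[of x] by simp

lemma mult_adj_self_eq_0: "x * adj x = 0 \<Longrightarrow> x = (0::'a::cstar_algebra)"
  using adj_mult_self_eq_0[of "adj x"] by (metis adj_adj adj_zero)

section \<open>Star-automorphisms are contractive\<close>

text \<open>
  The element \<open>1 - k\<close> of the unitization is a square root of \<open>1 - h\<^sup>2\<close>, so \<open>h + \<i> (1 - k)\<close> is a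
  unitary with real part \<open>h\<close>: if \<open>h\<close> is a cosine, then \<open>1 - k\<close> is the sine. The equation says that
  \<open>k\<close> is a fixed point of \<open>k \<mapsto> (h\<^sup>2 + k\<^sup>2) / 2\<close>, and this map is a contraction of a small ball.
\<close>

lemma cosine_partner:
  fixes h :: "'a::cstar_algebra"
  assumes sa: "adj h = h" and h: "norm h < 1"
  obtains k where "adj k = k" "k * h = h * k" "h * h + k * k = 2 *\<^sub>R k"
proof -
  define s where "s = norm h"
  \<comment> \<open>the smaller root of \<open>s\<^sup>2 + r\<^sup>2 = 2 * r\<close>: the ball of radius \<open>r\<close> is invariant and \<open>r < 1\<close> is the contraction factor\<close>
  define r where "r = 1 - sqrt (1 - s\<^sup>2)"
  have s: "0 \<le> s" "s < 1" by (auto simp: s_def h)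
  then have s2: "s\<^sup>2 < 1" by (simp add: power_less_one_iff)
  have r: "0 \<le> r" "r < 1" using s2 by (auto simp: r_def)
  have "(1 - r)\<^sup>2 = 1 - s\<^sup>2" using s2 by (simp add: r_def)
  then have rs: "s\<^sup>2 + r\<^sup>2 = 2 * r" by (simp add: power2_eq_square algebra_simps)
  define S where "S = {k::'a. norm k \<le> r \<and> adj k = k \<and> k * h = h * k}"
  define T where "T = (\<lambda>k. (1/2) *\<^sub>R (h * h + k * k))"
  have "closed S" unfolding S_def
    by (intro closed_Collect_conj closed_Collect_le closed_Collect_eq continuous_intros
        bounded_linear.continuous_on[OF bounded_linear_adj])
  then have "complete S" by (simp add: complete_eq_closed)
  moreover have "S \<noteq> {}" using r by (auto simp: S_def intro!: exI[of _ 0])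
  moreover have "T ` S \<subseteq> S"
  proof (clarsimp simp: S_def)
    fix k assume k: "norm k \<le> r" "adj k = k" "k * h = h * k"
    have "norm (h * h + k * k) \<le> s * s + r * r"
      by (intro order.trans[OF norm_triangle_ineq] add_mono order.trans[OF norm_mult_ineq] mult_mono)
         (auto simp: s_def k r)
    then have "norm (T k) \<le> r" using rs by (simp add: T_def power2_eq_square)
    moreover have "adj (T k) = T k" by (simp add: T_def adj_scaleR adj_add adj_mult sa k)
    moreover have "T k * h = h * T k"
    proof -
      have "k * k * h = h * (k * k)" by (metis k(3) mult.assoc)
      then show ?thesis by (simp add: T_def distrib_left distrib_right mult.assoc)
    qed
    ultimately show "norm (T k) \<le> r \<and> adj (T k) = T k \<and> T k * h = h * T k" by simp
  qed
  moreover have "dist (T x) (T y) \<le> r * dist x y" if "x \<in> S" "y \<in> S" for x y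
  proof -
    have "T x - T y = (1/2) *\<^sub>R (x * (x - y) + (x - y) * y)"
      by (simp add: T_def algebra_simps)
    moreover have "norm (x * (x - y) + (x - y) * y) \<le> r * norm (x - y) + norm (x - y) * r"
      using that r by (intro order.trans[OF norm_triangle_ineq] add_mono order.trans[OF norm_mult_ineq]
          mult_mono) (auto simp: S_def)
    ultimately show ?thesis by (simp add: dist_norm)
  qed
  ultimately obtain k where "k \<in> S" "T k = k"
    using Banach_fix[of S r T] r by blast
  moreover have "h * h + k * k = 2 *\<^sub>R T k" by (simp add: T_def)
  ultimately show thesis using that[of k] by (simp add: S_def)
qed

text \<open>
  Left multiplication by the unitary \<open>u = g + \<i> (1 - l)\<close> of the unitization and by its adjoint are
  isometries of the algebra itself, and \<open>2 * g = u + adj u\<close>.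
\<close>

lemma norm_le_one_if_cosine_partner:
  fixes g l :: "'a::cstar_algebra"
  assumes g: "adj g = g" and l: "adj l = l" and comm: "l * g = g * l"
    and eq: "g * g + l * l = 2 *\<^sub>R l"
  shows "norm g \<le> 1"
proof -
  have isom: "norm (g * a + cscale c (a - l * a)) = norm a" if c: "cnj c = - c" "c * c = - 1" for a c
  proof -
    have c1: "c * cnj c = 1" using c by simp
    have [simp]: "l * (g * x) = g * (l * x)" for x by (metis comm mult.assoc)
    have "adj (g * a + cscale c (a - l * a)) * (g * a + cscale c (a - l * a))
        = adj a * (g * (g * a) + (a - l * a) - l * (a - l * a))"
      using c(2) unfolding adj_add adj_cscale adj_mult adj_diff g l c(1)
      by (simp add: algebra_simps cscale_mult_left cscale_mult_right cscale_cscale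
          cscale.diff_right cscale.minus_left cscale_add_right)
    also have "g * (g * a) + (a - l * a) - l * (a - l * a) = (g * g + l * l - 2 *\<^sub>R l) * a + a"
      by (simp add: algebra_simps scaleR_2)
    finally have "adj (g * a + cscale c (a - l * a)) * (g * a + cscale c (a - l * a)) = adj a * a"
      by (simp add: eq)
    then show ?thesis
      by (metis cstar_identity norm_ge_zero power2_eq_imp_eq)
  qed
  let ?u = "g * g + cscale \<i> (g - l * g)" and ?v = "g * g + cscale (- \<i>) (g - l * g)"
  have "?u + ?v = 2 *\<^sub>R (g * g)"
    by (simp add: cscale.minus_left scaleR_2)
  then have "norm (2 *\<^sub>R (g * g)) \<le> norm ?u + norm ?v" by (metis norm_triangle_ineq)
  moreover have "norm ?u = norm g" "norm ?v = norm g" by (rule isom; simp)+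
  moreover have "norm (g * g) = (norm g)\<^sup>2" using cstar_identity[of g] by (simp add: g)
  ultimately have "norm g * norm g \<le> 1 * norm g" by (simp add: power2_eq_square)
  then show ?thesis by (cases "norm g = 0") (simp_all add: mult_le_cancel_right)
qed

lemma star_automorphism_linear:
  assumes "star_automorphism f"
  shows "f (x + y) = f x + f y" "f (cscale c x) = cscale c (f x)" "f (x * y) = f x * f y"
    "f (adj x) = adj (f x)" "f (r *\<^sub>R x) = r *\<^sub>R f x"
proof -
  show cs: "f (cscale c x) = cscale c (f x)" for c x
    using assms by (simp add: star_automorphism_def)
  show "f (r *\<^sub>R x) = r *\<^sub>R f x"
    unfolding cscale_of_real[symmetric] by (rule cs)
qed (use assms in \<open>simp_all add: star_automorphism_def\<close>)

text \<open>
  Being a partner is expressed by algebraic identities, so \<open>f k\<close> is a partner of \<open>f h\<close>. This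
  bounds \<open>f\<close> on self-adjoint elements, and the C*-identity extends the bound to all elements.
\<close>

lemma star_automorphism_contractive:
  assumes f: "star_automorphism f"
  shows "norm (f x) \<le> norm x"
proof -
  note f' = star_automorphism_linear[OF f]
  have unit: "norm (f h) \<le> 1" if h: "adj h = h" "norm h < 1" for h
  proof -
    obtain k where k: "adj k = k" "k * h = h * k" "h * h + k * k = 2 *\<^sub>R k"
      by (rule cosine_partner[OF h])
    show ?thesis
    proof (rule norm_le_one_if_cosine_partner[of "f h" "f k"])
      show "f h * f h + f k * f k = 2 *\<^sub>R f k"
        using arg_cong[OF k(3), of f] unfolding f'(1,3,5) .
      show "f k * f h = f h * f k" using arg_cong[OF k(2), of f] unfolding f'(3) .
      show "adj (f h) = f h" "adj (f k) = f k"
        using arg_cong[OF h(1), of f] arg_cong[OF k(1), of f] unfolding f'(4) by auto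
    qed
  qed
  have sa: "norm (f h) \<le> norm h" if "adj h = h" for h
  proof (rule dense_ge)
    fix s assume s: "norm h < s"
    then have s0: "0 < s" by (meson norm_ge_zero order.strict_trans1)
    have "norm ((1/s) *\<^sub>R h) < 1" using s s0 by simp
    then have "norm (f ((1/s) *\<^sub>R h)) \<le> 1"
      using that by (intro unit) (simp_all add: adj_scaleR)
    then have "norm (f h) / s \<le> 1" using s0 by (simp add: f'(5))
    then show "norm (f h) \<le> s" using s0 by simp
  qed
  have "(norm (f x))\<^sup>2 = norm (f (adj x * x))"
    by (simp add: f'(3,4) cstar_identity)
  also have "\<dots> \<le> norm (adj x * x)" by (rule sa) (simp add: adj_mult adj_adj)
  also have "\<dots> = (norm x)\<^sup>2" by (rule cstar_identity)
  finally show ?thesis by (rule power2_le_imp_le) simp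
qed

lemma star_automorphism_bounded_linear:
  "star_automorphism f \<Longrightarrow> bounded_linear f"
  using star_automorphism_linear(1,5)[of f] star_automorphism_contractive[of f]
  by (intro bounded_linear_intro[where K = 1]) simp_all

section \<open>Spans of products\<close>

lemma complex_subspaceD:
  assumes "complex_subspace S"
  shows "0 \<in> S" "\<And>x y. x \<in> S \<Longrightarrow> y \<in> S \<Longrightarrow> x + y \<in> S" "\<And>c x. x \<in> S \<Longrightarrow> cscale c x \<in> S"
  using assms by (auto simp: complex_subspace_def)

lemma complex_subspace_set_plus:
  fixes S :: "'a::cstar_algebra set"
  assumes "complex_subspace S" "complex_subspace T"
  shows "complex_subspace (S + T)"
proof -
  note D = complex_subspaceD[OF assms(1)] complex_subspaceD[OF assms(2)]
  have "x + y \<in> S + T" if "x \<in> S + T" "y \<in> S + T" for x y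
  proof -
    from that obtain s t s' t' where "s \<in> S" "t \<in> T" "x = s + t" "s' \<in> S" "t' \<in> T" "y = s' + t'"
      by (auto simp: set_plus_def)
    moreover from this have "x + y = (s + s') + (t + t')" by simp
    ultimately show ?thesis using D by (metis set_plus_intro)
  qed
  moreover have "cscale c x \<in> S + T" if "x \<in> S + T" for c x
    using that D(3) D(6) by (fastforce simp: set_plus_def cscale_add_right)
  moreover have "0 \<in> S + T" using set_plus_intro[OF D(1) D(4)] by simp
  ultimately show ?thesis by (simp add: complex_subspace_def)
qed

lemma complex_subspace_closure:
  fixes S :: "'a::cstar_algebra set"
  assumes "complex_subspace S"
  shows "complex_subspace (closure S)"
proof -
  note D = complex_subspaceD[OF assms]
  have "x + y \<in> closure S" if "x \<in> closure S" "y \<in> closure S" for x y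
  proof -
    have "(\<lambda>p. fst p + snd p) ` closure (S \<times> S) \<subseteq> closure S"
      using D(2) closure_subset[of S]
      by (intro image_closure_subset) (auto intro!: continuous_intros)
    then show ?thesis using that by (force simp: closure_Times)
  qed
  moreover have "cscale c x \<in> closure S" if "x \<in> closure S" for c x
  proof -
    have "cscale c ` closure S \<subseteq> closure S"
      using D(3) closure_subset[of S]
      by (intro image_closure_subset) (auto intro!: cscale.continuous_on continuous_intros)
    then show ?thesis using that by blast
  qed
  ultimately show ?thesis
    using D(1) closure_subset[of S] by (auto simp: complex_subspace_def)
qed

lemma subspace_product_sumI:
  "(\<And>i. i < m \<Longrightarrow> x i \<in> X \<and> y i \<in> Y) \<Longrightarrow> (\<Sum>i<m::nat. x i * y i) \<in> subspace_product X Y"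
  unfolding subspace_product_def by blast

lemma subspace_productI:
  "x \<in> X \<Longrightarrow> y \<in> Y \<Longrightarrow> x * y \<in> subspace_product X Y"
  using subspace_product_sumI[of 1 "\<lambda>_. x" X "\<lambda>_. y" Y] by simp

lemma complex_subspace_subspace_product:
  fixes X Y :: "'a::cstar_algebra set"
  assumes X: "complex_subspace X"
  shows "complex_subspace (subspace_product X Y)"
proof -
  let ?P = "subspace_product X Y"
  have "0 \<in> ?P"
    using subspace_product_sumI[of 0 "\<lambda>_. 0" X "\<lambda>_. 0" Y] by simp
  moreover have "p + q \<in> ?P" if "p \<in> ?P" "q \<in> ?P" for p q
  proof -
    from that obtain m x y m' x' y' where
      p: "p = (\<Sum>i<m::nat. x i * y i)" "\<forall>i<m. x i \<in> X \<and> y i \<in> Y" and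
      q: "q = (\<Sum>i<m'::nat. x' i * y' i)" "\<forall>i<m'. x' i \<in> X \<and> y' i \<in> Y"
      unfolding subspace_product_def by blast
    define x'' where "x'' = (\<lambda>i. if i < m then x i else x' (i - m))"
    define y'' where "y'' = (\<lambda>i. if i < m then y i else y' (i - m))"
    have "(\<Sum>i<m + m'. x'' i * y'' i) = (\<Sum>i<m. x'' i * y'' i) + (\<Sum>i<m'. x'' (m + i) * y'' (m + i))"
      by (induction m') (simp_all add: add.assoc)
    also have "\<dots> = p + q" by (simp add: p q x''_def y''_def)
    finally have "p + q = (\<Sum>i<m + m'. x'' i * y'' i)" by simp
    also have "\<dots> \<in> ?P"
      by (rule subspace_product_sumI) (use p q in \<open>auto simp: x''_def y''_def\<close>)
    finally show ?thesis .
  qed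
  moreover have "cscale c p \<in> ?P" if "p \<in> ?P" for c p
  proof -
    from that obtain m x y where p: "p = (\<Sum>i<m::nat. x i * y i)" "\<forall>i<m. x i \<in> X \<and> y i \<in> Y"
      unfolding subspace_product_def by blast
    have "cscale c p = (\<Sum>i<m. cscale c (x i) * y i)"
      unfolding p(1) by (simp add: cscale.sum_right cscale_mult_left)
    also have "\<dots> \<in> ?P"
      by (rule subspace_product_sumI) (use p complex_subspaceD[OF X] in auto)
    finally show ?thesis .
  qed
  ultimately show ?thesis by (simp add: complex_subspace_def)
qed

lemma subspace_product_induct [consumes 1, case_names zero add mult]:
  fixes X Y :: "'a::cstar_algebra set"
  assumes "p \<in> subspace_product X Y" "P 0" "\<And>x y. P x \<Longrightarrow> P y \<Longrightarrow> P (x + y)"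
    and "\<And>x y. x \<in> X \<Longrightarrow> y \<in> Y \<Longrightarrow> P (x * y)"
  shows "P p"
proof -
  from assms(1) obtain m x y where p: "p = (\<Sum>i<m::nat. x i * y i)" "\<forall>i<m. x i \<in> X \<and> y i \<in> Y"
    unfolding subspace_product_def by blast
  show ?thesis unfolding p(1) using p(2) by (induction m) (auto intro: assms)
qed

text \<open>
  A map that is linear and continuous takes the closed span of the products into a closed subspace
  \<open>K\<close> as soon as it takes the products there. Multiplication by fixed factors on both sides or on
  one side is such a map, and there is no unit to derive the one-sided versions from the first.
\<close>

lemma closure_product_sandwich:
  fixes K :: "'a::cstar_algebra set"
  assumes K: "complex_subspace K" "closed K"
    and p: "p \<in> closure (subspace_product X Y)"
    and base: "\<And>x y. x \<in> X \<Longrightarrow> y \<in> Y \<Longrightarrow> u * (x * y) * v \<in> K"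
  shows "u * p * v \<in> K"
proof -
  have "u * q * v \<in> K" if "q \<in> subspace_product X Y" for q
    using that complex_subspaceD(1,2)[OF K(1)] base
    by (induction rule: subspace_product_induct) (auto simp: distrib_left distrib_right)
  then have "(\<lambda>q. u * q * v) ` closure (subspace_product X Y) \<subseteq> K"
    by (intro image_closure_subset continuous_intros K) auto
  with p show ?thesis by blast
qed

lemma closure_product_left:
  fixes K :: "'a::cstar_algebra set"
  assumes K: "complex_subspace K" "closed K"
    and p: "p \<in> closure (subspace_product X Y)"
    and base: "\<And>x y. x \<in> X \<Longrightarrow> y \<in> Y \<Longrightarrow> (x * y) * v \<in> K"
  shows "p * v \<in> K"
proof -
  have "q * v \<in> K" if "q \<in> subspace_product X Y" for q
    using that complex_subspaceD(1,2)[OF K(1)] base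
    by (induction rule: subspace_product_induct) (auto simp: distrib_right)
  then have "(\<lambda>q. q * v) ` closure (subspace_product X Y) \<subseteq> K"
    by (intro image_closure_subset continuous_intros K) auto
  with p show ?thesis by blast
qed

lemma closure_product_right:
  fixes K :: "'a::cstar_algebra set"
  assumes K: "complex_subspace K" "closed K"
    and p: "p \<in> closure (subspace_product X Y)"
    and base: "\<And>x y. x \<in> X \<Longrightarrow> y \<in> Y \<Longrightarrow> u * (x * y) \<in> K"
  shows "u * p \<in> K"
proof -
  have "u * q \<in> K" if "q \<in> subspace_product X Y" for q
    using that complex_subspaceD(1,2)[OF K(1)] base
    by (induction rule: subspace_product_induct) (auto simp: distrib_left)
  then have "(\<lambda>q. u * q) ` closure (subspace_product X Y) \<subseteq> K"
    by (intro image_closure_subset continuous_intros K) auto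
  with p show ?thesis by blast
qed

lemma closure_product_subset:
  fixes K :: "'a::cstar_algebra set"
  assumes K: "complex_subspace K" "closed K"
    and base: "\<And>x y. x \<in> X \<Longrightarrow> y \<in> Y \<Longrightarrow> x * y \<in> K"
  shows "closure (subspace_product X Y) \<subseteq> K"
proof -
  have "q \<in> K" if "q \<in> subspace_product X Y" for q
    using that complex_subspaceD(1,2)[OF K(1)] base
    by (induction rule: subspace_product_induct) auto
  then show ?thesis by (intro closure_minimal K subsetI)
qed

lemma adj_subspace_product:
  fixes X Y :: "'a::cstar_algebra set"
  assumes "complex_subspace X'" "\<And>x. x \<in> X \<Longrightarrow> adj x \<in> Y'" "\<And>y. y \<in> Y \<Longrightarrow> adj y \<in> X'"
    and "p \<in> subspace_product X Y"
  shows "adj p \<in> subspace_product X' Y'"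
  using assms(4)
  by (induction rule: subspace_product_induct)
     (auto simp: adj_add adj_mult intro: complex_subspaceD(1,2)[OF complex_subspace_subspace_product]
       assms subspace_productI)

lemma adj_closure:
  fixes S :: "'a::cstar_algebra set"
  assumes "\<And>x. x \<in> S \<Longrightarrow> adj x \<in> T" "x \<in> closure S"
  shows "adj x \<in> closure T"
proof -
  have "adj ` closure S \<subseteq> closure T"
    using assms(1) closure_subset[of T] by (intro image_closure_subset)
       (auto intro!: bounded_linear.continuous_on[OF bounded_linear_adj] continuous_intros)
  with assms(2) show ?thesis by blast
qed

lemma cstar_subalgebra_closure:
  fixes S :: "'a::cstar_algebra set"
  assumes S: "complex_subspace S" and mult: "\<And>x y. x \<in> S \<Longrightarrow> y \<in> S \<Longrightarrow> x * y \<in> S"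
    and adj: "\<And>x. x \<in> S \<Longrightarrow> adj x \<in> S"
  shows "cstar_subalgebra (closure S)"
proof -
  have "(\<lambda>p. fst p * snd p) ` closure (S \<times> S) \<subseteq> closure S"
    using mult closure_subset[of S] by (intro image_closure_subset) (auto intro!: continuous_intros)
  then have "\<forall>x\<in>closure S. \<forall>y\<in>closure S. x * y \<in> closure S" by (force simp: closure_Times)
  then show ?thesis
    using complex_subspace_closure[OF S] adj_closure[OF adj] by (auto simp: cstar_subalgebra_def)
qed

section \<open>Linking algebras over a simple corner\<close>

text \<open>
  In the graded situation \<open>B\<close> consists of two by two matrices with diagonal corners \<open>I\<close> and \<open>J\<close>, upper
  right corner \<open>X\<close> and lower left corner \<open>Y\<close>. Of this picture only the condition \<open>X * A * Y \<subseteq> I\<close> is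
  kept, which makes \<open>I\<close> hereditary in the whole algebra.
\<close>

locale corner_bimodule =
  fixes X Y I J L B :: "'a::cstar_algebra set"
  defines "I \<equiv> closure (subspace_product X Y)"
    and "J \<equiv> closure (subspace_product Y X)"
    and "L \<equiv> I + J"
    and "B \<equiv> closure (subspace_product (subspace_product L UNIV) L)"
  assumes X: "complex_subspace X" and Y: "complex_subspace Y"
    and adj_X: "\<And>x. x \<in> X \<Longrightarrow> adj x \<in> Y" and adj_Y: "\<And>y. y \<in> Y \<Longrightarrow> adj y \<in> X"
    and XAY: "\<And>x a y. x \<in> X \<Longrightarrow> y \<in> Y \<Longrightarrow> x * a * y \<in> I"
    and simple_I: "simple_cstar_algebra I"
begin

lemma csub_I: "complex_subspace I" and closed_I: "closed I"
  and mult_I: "\<And>x y. x \<in> I \<Longrightarrow> y \<in> I \<Longrightarrow> x * y \<in> I" and adj_I: "\<And>x. x \<in> I \<Longrightarrow> adj x \<in> I"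
  using simple_I unfolding simple_cstar_algebra_def cstar_subalgebra_def by simp_all

lemma csub_J: "complex_subspace J"
  unfolding J_def by (intro complex_subspace_closure complex_subspace_subspace_product Y)

lemma adj_J: "j \<in> J \<Longrightarrow> adj j \<in> J"
  unfolding J_def by (rule adj_closure[OF adj_subspace_product[OF Y adj_Y adj_X]])

lemma csub_L: "complex_subspace L"
  unfolding L_def by (rule complex_subspace_set_plus[OF csub_I csub_J])

lemma I_sub_L: "I \<subseteq> L" and J_sub_L: "J \<subseteq> L"
  unfolding L_def
  using set_plus_intro[OF _ complex_subspaceD(1)[OF csub_J], of _ I]
    set_plus_intro[OF complex_subspaceD(1)[OF csub_I], of _ J]
  by auto

lemma adj_L: assumes "l \<in> L" shows "adj l \<in> L"
proof -
  obtain i j where "l = i + j" "i \<in> I" "j \<in> J"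
    using assms unfolding L_def by (rule set_plus_elim)
  then show ?thesis unfolding L_def by (simp add: adj_add adj_I adj_J set_plus_intro)
qed

lemma YX_in_J: "y \<in> Y \<Longrightarrow> x \<in> X \<Longrightarrow> y * x \<in> J"
  unfolding J_def by (rule subsetD[OF closure_subset subspace_productI])

lemma cstar_subalgebra_B: "cstar_subalgebra B"
  unfolding B_def
proof (rule cstar_subalgebra_closure)
  let ?R = "subspace_product L UNIV" and ?P = "subspace_product (subspace_product L UNIV) L"
  have R: "complex_subspace ?R" by (rule complex_subspace_subspace_product[OF csub_L])
  show P: "complex_subspace ?P" by (rule complex_subspace_subspace_product[OF R])
  note RD = complex_subspaceD[OF R] and PD = complex_subspaceD[OF P]
  \<comment> \<open>\<open>?P\<close> is contained in the right ideal \<open>?R\<close> that it is built from; therefore it is closed under products\<close>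
  have R_right: "r * a \<in> ?R" if "r \<in> ?R" for r a
    using that
  proof (induction rule: subspace_product_induct)
    case (mult l b)
    then show ?case using subspace_productI[of l L "b * a" UNIV] by (simp add: mult.assoc)
  qed (use RD in \<open>auto simp: distrib_right\<close>)
  have P_R: "p \<in> ?R" if "p \<in> ?P" for p
    using that by (induction rule: subspace_product_induct) (use RD R_right in auto)
  show "p * q \<in> ?P" if p: "p \<in> ?P" and q: "q \<in> ?P" for p q
    using q
  proof (induction rule: subspace_product_induct)
    case (mult r l)
    then show ?case using subspace_productI[OF R_right[OF P_R[OF p], of r], of l L]
      by (simp add: mult.assoc)
  qed (use PD in \<open>auto simp: distrib_left\<close>)
  have lR: "l * adj r \<in> ?P" if "l \<in> L" "r \<in> ?R" for l r
    using that(2)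
  proof (induction rule: subspace_product_induct)
    case (mult l' a)
    then show ?case
      using subspace_productI[OF subspace_productI[OF that(1) UNIV_I, of "adj a"], of "adj l'" L] adj_L
      by (simp add: adj_mult mult.assoc)
  qed (use PD in \<open>auto simp: distrib_left adj_add\<close>)
  show "adj p \<in> ?P" if "p \<in> ?P" for p
    using that
    by (induction rule: subspace_product_induct) (use PD lR adj_L in \<open>auto simp: adj_add adj_mult\<close>)
qed

lemma csub_B: "complex_subspace B" and closed_B: "closed B" and adj_B: "\<And>x. x \<in> B \<Longrightarrow> adj x \<in> B"
  using cstar_subalgebra_B unfolding cstar_subalgebra_def by simp_all

lemma LAL_in_B: "l \<in> L \<Longrightarrow> l' \<in> L \<Longrightarrow> l * a * l' \<in> B"
  unfolding B_def
  by (rule subsetD[OF closure_subset subspace_productI[OF subspace_productI[OF _ UNIV_I]]])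

lemma B_subset:
  assumes K: "complex_subspace K" "closed K"
    and LAL: "\<And>l a l'. l \<in> L \<Longrightarrow> l' \<in> L \<Longrightarrow> l * a * l' \<in> K"
  shows "B \<subseteq> K"
  unfolding B_def
proof (rule closure_product_subset[OF K])
  fix r l assume "r \<in> subspace_product L UNIV" and l: "l \<in> L"
  then show "r * l \<in> K"
    by (induction rule: subspace_product_induct)
       (use complex_subspaceD[OF K(1)] LAL in \<open>auto simp: distrib_right\<close>)
qed

text \<open>
  The right-hand side is a closed ideal of \<open>I\<close>, and it contains \<open>adj i * i\<close>, so it is not zero.
  Simplicity of \<open>I\<close> thus replaces the approximate unit of \<open>I\<close>.
\<close>

lemma I_eq_closure_II: "I = closure (subspace_product I I)"
proof -
  let ?K = "closure (subspace_product I I)"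
  have K: "complex_subspace ?K" "closed ?K"
    by (auto intro: complex_subspace_closure complex_subspace_subspace_product csub_I)
  have prod: "i * i' \<in> ?K" if "i \<in> I" "i' \<in> I" for i i'
    by (rule subsetD[OF closure_subset subspace_productI[OF that]])
  have sub: "?K \<subseteq> I" by (rule closure_product_subset[OF csub_I closed_I mult_I])
  then have "closed_ideal_of ?K I"
    using K prod by (auto simp: closed_ideal_of_def)
  then have "?K = {0} \<or> ?K = I" using simple_I by (auto simp: simple_cstar_algebra_def)
  moreover have "?K \<noteq> {0}"
  proof
    assume "?K = {0}"
    then have "i = 0" if "i \<in> I" for i
      using prod[OF adj_I that] that adj_mult_self_eq_0 by blast
    then have "I = {0}" using complex_subspaceD(1)[OF csub_I] by blast
    then show False using simple_I by (simp add: simple_cstar_algebra_def)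
  qed
  ultimately show ?thesis by simp
qed

lemmas I_sub_closure_II = equalityD1[OF I_eq_closure_II]

lemma factor_I:
  assumes K: "complex_subspace K" "closed K" and "i \<in> I"
    and "\<And>i1 i2. i1 \<in> I \<Longrightarrow> i2 \<in> I \<Longrightarrow> u * (i1 * i2) * v \<in> K"
  shows "u * i * v \<in> K"
  by (rule closure_product_sandwich[OF K assms(3)[THEN I_sub_closure_II[THEN subsetD]] assms(4)])

lemma factor_I_left:
  assumes K: "complex_subspace K" "closed K" and "i \<in> I"
    and "\<And>i1 i2. i1 \<in> I \<Longrightarrow> i2 \<in> I \<Longrightarrow> (i1 * i2) * v \<in> K"
  shows "i * v \<in> K"
  by (rule closure_product_left[OF K assms(3)[THEN I_sub_closure_II[THEN subsetD]] assms(4)])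

lemma factor_I_right:
  assumes K: "complex_subspace K" "closed K" and "i \<in> I"
    and "\<And>i1 i2. i1 \<in> I \<Longrightarrow> i2 \<in> I \<Longrightarrow> u * (i1 * i2) \<in> K"
  shows "u * i \<in> K"
  by (rule closure_product_right[OF K assms(3)[THEN I_sub_closure_II[THEN subsetD]] assms(4)])

lemma I_sub_B: "I \<subseteq> B"
proof -
  have "i * i' \<in> B" if "i \<in> I" "i' \<in> I" for i i'
    by (rule factor_I_left[OF csub_B closed_B that(1)]) (use that I_sub_L in \<open>auto intro!: LAL_in_B\<close>)
  then show ?thesis
    by (rule order.trans[OF I_sub_closure_II closure_product_subset[OF csub_B closed_B]])
qed

text \<open>
  Although \<open>Y\<close> itself is not known to lie in \<open>B\<close>, an element of \<open>Y * (X * Y) * I\<close> regroups as one of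
  \<open>(Y * X) * Y * I \<subseteq> J * A * I\<close>, and such elements span \<open>Y * I\<close> densely.
\<close>

lemma YI_in_B: "y \<in> Y \<Longrightarrow> i \<in> I \<Longrightarrow> y * i \<in> B"
proof (rule factor_I_right[OF csub_B closed_B])
  fix i1 i2 assume y: "y \<in> Y" and i: "i1 \<in> I" "i2 \<in> I"
  have "i1 \<in> closure (subspace_product X Y)" using i(1) by (simp add: I_def)
  then have "y * i1 * i2 \<in> B"
  proof (rule closure_product_sandwich[OF csub_B closed_B])
    fix x y' assume "x \<in> X" "y' \<in> Y"
    then have "(y * x) * y' * i2 \<in> B"
      using YX_in_J y i J_sub_L I_sub_L by (intro LAL_in_B) auto
    then show "y * (x * y') * i2 \<in> B" by (simp add: mult.assoc)
  qed
  then show "y * (i1 * i2) \<in> B" by (simp add: mult.assoc)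
qed

lemma IX_in_B:
  assumes "i \<in> I" "x \<in> X" shows "i * x \<in> B"
  using adj_B[OF YI_in_B[OF adj_X adj_I, OF assms(2,1)]] by (simp add: adj_mult adj_adj)

text \<open>
  Approximate both elements of \<open>I\<close> by sums of products: \<open>(x * y) * a * (x' * y')\<close> is
  \<open>x * (y * a * x') * y'\<close>, an element of \<open>X * A * Y\<close>.
\<close>

lemma IAI_in_I:
  assumes "i \<in> I" "i' \<in> I" shows "i * a * i' \<in> I"
proof -
  have *: "x * (y * (a * i')) \<in> I" if "x \<in> X" "y \<in> Y" for x y
  proof -
    have "(x * y * a) * i' \<in> I"
    proof (rule closure_product_right[OF csub_I closed_I, of i' X Y])
      show "i' \<in> closure (subspace_product X Y)" using assms(2) by (simp add: I_def)
      show "x * y * a * (x' * y') \<in> I" if "x' \<in> X" "y' \<in> Y" for x' y'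
        using XAY[OF \<open>x \<in> X\<close> that(2), of "y * a * x'"] by (simp add: mult.assoc)
    qed
    then show ?thesis by (simp add: mult.assoc)
  qed
  have "i * (a * i') \<in> I"
    by (rule closure_product_left[OF csub_I closed_I, of i X Y])
       (use assms(1) * in \<open>auto simp: I_def mult.assoc\<close>)
  then show ?thesis by (simp add: mult.assoc)
qed

text \<open>
  Of the parts of \<open>(I + J) * A * (I + J)\<close> only \<open>J * A * J\<close> does not have a factor from \<open>I\<close> at an end. It
  is spanned by \<open>y * (x * a * y') * x'\<close>, where the middle factor lies in \<open>I\<close>; splitting that
  element into three factors from \<open>I\<close> gives a product of \<open>Y * I \<subseteq> B\<close>, \<open>I \<subseteq> K\<close> and \<open>I * X \<subseteq> B\<close>.
\<close>

lemma ideal_containing_I: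
  assumes K: "closed_ideal_of K B" and IK: "I \<subseteq> K"
  shows "K = B"
proof -
  have csK: "complex_subspace K" and clK: "closed K" and KB: "K \<subseteq> B"
    and Kl: "\<And>b k. b \<in> B \<Longrightarrow> k \<in> K \<Longrightarrow> b * k \<in> K" and Kr: "\<And>b k. b \<in> B \<Longrightarrow> k \<in> K \<Longrightarrow> k * b \<in> K"
    using K by (auto simp: closed_ideal_of_def)
  have YIX: "y * i * x \<in> K" if y: "y \<in> Y" and x: "x \<in> X" and i: "i \<in> I" for y i x
  proof (rule factor_I[OF csK clK i])
    fix i1 i2 assume i1: "i1 \<in> I" and i2: "i2 \<in> I"
    have "(y * i1) * i2 * x \<in> K"
    proof (rule factor_I[OF csK clK i2])
      fix i3 i4 assume "i3 \<in> I" "i4 \<in> I"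
      then have "(y * i1) * i3 * (i4 * x) \<in> K"
        using YI_in_B[OF y i1] IX_in_B[OF _ x, of i4] IK by (intro Kr Kl) auto
      then show "(y * i1) * (i3 * i4) * x \<in> K" by (simp add: mult.assoc)
    qed
    then show "y * (i1 * i2) * x \<in> K" by (simp add: mult.assoc)
  qed
  have IAL: "i * (a * l) \<in> K" if i: "i \<in> I" and l: "l \<in> L" for i a l
  proof (rule factor_I_left[OF csK clK i])
    fix i1 i2 assume "i1 \<in> I" "i2 \<in> I"
    then have "i1 * (i2 * a * l) \<in> K" using IK l I_sub_L by (intro Kr LAL_in_B) auto
    then show "i1 * i2 * (a * l) \<in> K" by (simp add: mult.assoc)
  qed
  have LAI: "l * a * i \<in> K" if i: "i \<in> I" and l: "l \<in> L" for i a l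
  proof (rule factor_I_right[OF csK clK i])
    fix i1 i2 assume "i1 \<in> I" "i2 \<in> I"
    then have "(l * a * i1) * i2 \<in> K" using IK l I_sub_L by (intro Kl LAL_in_B) auto
    then show "l * a * (i1 * i2) \<in> K" by (simp add: mult.assoc)
  qed
  have JAJ: "j * (a * j') \<in> K" if j: "j \<in> J" and j': "j' \<in> J" for j a j'
  proof (rule closure_product_left[OF csK clK])
    show "j \<in> closure (subspace_product Y X)" using j by (simp add: J_def)
    fix y x assume y: "y \<in> Y" and x: "x \<in> X"
    have "(y * x * a) * j' \<in> K"
    proof (rule closure_product_right[OF csK clK])
      show "j' \<in> closure (subspace_product Y X)" using j' by (simp add: J_def)
      fix y' x' assume "y' \<in> Y" "x' \<in> X"
      then have "y * (x * a * y') * x' \<in> K" using x y by (intro YIX XAY)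
      then show "(y * x * a) * (y' * x') \<in> K" by (simp add: mult.assoc)
    qed
    then show "y * x * (a * j') \<in> K" by (simp add: mult.assoc)
  qed
  have "l * a * l' \<in> K" if "l \<in> L" and l': "l' \<in> L" for l a l'
  proof -
    obtain i j where l: "l = i + j" and i: "i \<in> I" and j: "j \<in> J"
      using \<open>l \<in> L\<close> by (auto simp: L_def set_plus_def)
    obtain i' j' where l'': "l' = i' + j'" and i': "i' \<in> I" and j': "j' \<in> J"
      using l' by (auto simp: L_def set_plus_def)
    have "l * a * l' = i * (a * l') + (j * a * i' + j * (a * j'))"
      by (simp add: l l'' distrib_left distrib_right mult.assoc)
    then show ?thesis
      using IAL[OF i l'] LAI[OF i', of j] J_sub_L j JAJ[OF j j'] complex_subspaceD(2)[OF csK]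
      by (metis subsetD)
  qed
  then show ?thesis using B_subset[OF csK clK] KB by blast
qed

text \<open>
  Since \<open>I * K * I\<close> and \<open>I * (X * K * Y) * I\<close> lie in \<open>K \<inter> I\<close>, the ideal \<open>K\<close> is annihilated from the
  left successively by \<open>I\<close>, by \<open>J\<close> and by \<open>B\<close>, hence by its own adjoints.
\<close>

lemma ideal_disjoint_from_I:
  assumes K: "closed_ideal_of K B" and KI: "K \<inter> I = {0}"
  shows "K = {0}"
proof -
  have KB: "K \<subseteq> B" and Kl: "\<And>b k. b \<in> B \<Longrightarrow> k \<in> K \<Longrightarrow> b * k \<in> K"
    and Kr: "\<And>b k. b \<in> B \<Longrightarrow> k \<in> K \<Longrightarrow> k * b \<in> K" and K0: "0 \<in> K"
    using K by (auto simp: closed_ideal_of_def complex_subspace_def)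
  have zero: "complex_subspace {0::'a}" "closed {0::'a}" by (auto simp: complex_subspace_def)
  have kk: "k * adj k \<in> K" if "k \<in> K" for k using that KB adj_B Kr by blast
  have IK: "i * k = 0" if i: "i \<in> I" and k: "k \<in> K" for i k
  proof -
    have "i * (k * adj k) * adj i \<in> K \<inter> I"
      using IAI_in_I[OF i adj_I[OF i]] Kl[OF _ kk[OF k], of i] Kr[of "adj i"] i adj_I[OF i] I_sub_B
      by blast
    then have "(i * k) * adj (i * k) = 0" using KI by (auto simp: adj_mult mult.assoc)
    then show ?thesis by (rule mult_adj_self_eq_0)
  qed
  have XKY: "x * k * y = 0" if x: "x \<in> X" and y: "y \<in> Y" and k: "k \<in> K" for x k y
  proof -
    \<comment> \<open>\<open>c\<close> lies in \<open>I\<close> and perhaps not in \<open>K\<close>, but multiplying it by \<open>I\<close> on both sides leads into \<open>K\<close>\<close>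
    define c where "c = x * k * y"
    have cI: "c \<in> I" unfolding c_def by (rule XAY[OF x y])
    have "adj c * c * adj c = 0"
    proof -
      have a: "adj c \<in> I" by (rule adj_I[OF cI])
      have "(adj c * x) * k * (y * adj c) \<in> K"
        using IX_in_B[OF a x] YI_in_B[OF y a] k by (intro Kr Kl)
      moreover have "(adj c * x) * k * (y * adj c) = adj c * c * adj c" by (simp add: c_def mult.assoc)
      moreover have "adj c * c * adj c \<in> I" by (intro mult_I a cI)
      ultimately have "adj c * c * adj c \<in> K \<inter> I" by simp
      then show ?thesis unfolding KI by simp
    qed
    then have "adj (adj c * c) * (adj c * c) = 0" by (simp add: adj_mult adj_adj mult.assoc[symmetric])
    then show ?thesis unfolding c_def[symmetric] by (rule adj_mult_self_eq_0[OF adj_mult_self_eq_0])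
  qed
  have JKJ: "j * k * j' = 0" if j: "j \<in> J" and j': "j' \<in> J" and k: "k \<in> K" for j k j'
  proof -
    have "j * (k * j') \<in> {0}"
    proof (rule closure_product_left[OF zero])
      show "j \<in> closure (subspace_product Y X)" using j by (simp add: J_def)
      fix y x assume y: "y \<in> Y" and x: "x \<in> X"
      have "(y * x * k) * j' \<in> {0}"
      proof (rule closure_product_right[OF zero])
        show "j' \<in> closure (subspace_product Y X)" using j' by (simp add: J_def)
        fix y' x' assume "y' \<in> Y" "x' \<in> X"
        then have "y * (x * k * y') * x' = 0" using XKY[OF x _ k] by simp
        then show "(y * x * k) * (y' * x') \<in> {0}" by (simp add: mult.assoc)
      qed
      then show "y * x * (k * j') \<in> {0}" by (simp add: mult.assoc)
    qed
    then show ?thesis by (simp add: mult.assoc)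
  qed
  have JK: "j * k = 0" if j: "j \<in> J" and k: "k \<in> K" for j k
  proof (rule mult_adj_self_eq_0)
    show "j * k * adj (j * k) = 0"
      using JKJ[OF j adj_J[OF j] kk[OF k]] by (simp add: adj_mult mult.assoc)
  qed
  have LK: "l * k = 0" if "l \<in> L" "k \<in> K" for l k
    using that IK JK by (auto simp: L_def set_plus_def distrib_right)
  have BK: "b * k = 0" if "b \<in> B" "k \<in> K" for b k
    using closure_product_left[OF zero, of b "subspace_product L UNIV" L k] that LK
    by (auto simp: B_def mult.assoc)
  have "k = 0" if "k \<in> K" for k
    by (rule adj_mult_self_eq_0[OF BK[OF adj_B[OF subsetD[OF KB that]] that]])
  with K0 show ?thesis by blast
qed

theorem simple_B: "simple_cstar_algebra B"
  unfolding simple_cstar_algebra_def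
proof (intro conjI allI impI)
  show "cstar_subalgebra B" by (rule cstar_subalgebra_B)
  show "B \<noteq> {0}"
    using simple_I I_sub_B complex_subspaceD(1)[OF csub_I] by (auto simp: simple_cstar_algebra_def)
  fix K assume K: "closed_ideal_of K B"
  have "closed_ideal_of (K \<inter> I) I"
    using K csub_I closed_I mult_I subsetD[OF I_sub_B] unfolding closed_ideal_of_def complex_subspace_def
    by (simp add: closed_Int)
  then have "K \<inter> I = {0} \<or> K \<inter> I = I" using simple_I by (auto simp: simple_cstar_algebra_def)
  then show "K = {0} \<or> K = B" using ideal_containing_I[OF K] ideal_disjoint_from_I[OF K] by blast
qed

end

section \<open>Fourier coefficients on the circle\<close>

definition circle_mean :: "(complex \<Rightarrow> 'a::banach) \<Rightarrow> 'a" where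
  "circle_mean g = integral {0..1} (\<lambda>t. g (cis (2 * pi * t)))"

lemma continuous_on_cis_compose:
  fixes g :: "complex \<Rightarrow> 'a::topological_space"
  assumes "continuous_on (sphere 0 1) g"
  shows "continuous_on A (\<lambda>t. g (cis (2 * pi * t)))"
  by (rule continuous_on_compose2[OF assms]) (auto intro!: continuous_intros)

lemma integrable_circle:
  fixes g :: "complex \<Rightarrow> 'a::banach"
  assumes "continuous_on (sphere 0 1) g"
  shows "(\<lambda>t. g (cis (2 * pi * t))) integrable_on {a..b}"
  by (rule integrable_continuous_interval[OF continuous_on_cis_compose[OF assms]])

lemma circle_mean_cong:
  "(\<And>z. z \<in> sphere 0 1 \<Longrightarrow> f z = g z) \<Longrightarrow> circle_mean f = circle_mean g"
  unfolding circle_mean_def by (rule integral_cong) simp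

lemma circle_mean_const [simp]: "circle_mean (\<lambda>_. c) = c"
  by (simp add: circle_mean_def)

lemma circle_mean_add:
  "continuous_on (sphere 0 1) f \<Longrightarrow> continuous_on (sphere 0 1) g \<Longrightarrow>
    circle_mean (\<lambda>z. f z + g z) = circle_mean f + circle_mean g"
  unfolding circle_mean_def by (intro integral_add integrable_circle)

lemma circle_mean_diff:
  "continuous_on (sphere 0 1) f \<Longrightarrow> continuous_on (sphere 0 1) g \<Longrightarrow>
    circle_mean (\<lambda>z. f z - g z) = circle_mean f - circle_mean g"
  unfolding circle_mean_def by (intro integral_diff integrable_circle)

lemma circle_mean_linear:
  assumes "bounded_linear h" "continuous_on (sphere 0 1) f"
  shows "circle_mean (\<lambda>z. h (f z)) = h (circle_mean f)"
  unfolding circle_mean_def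
  using integral_linear[OF integrable_circle[OF assms(2)] assms(1)] by (simp add: o_def)

lemma norm_circle_mean_le:
  assumes f: "continuous_on (sphere 0 1) f" and g: "continuous_on (sphere 0 1) g"
    and le: "\<And>z. z \<in> sphere 0 1 \<Longrightarrow> norm (f z) \<le> g z"
  shows "norm (circle_mean f) \<le> circle_mean g"
  unfolding circle_mean_def
  by (rule integral_norm_bound_integral) (auto intro: integrable_circle f g le)

text \<open>
  A rotation translates the parameter interval of length one, and the part that leaves the interval
  re-enters by periodicity.
\<close>

lemma circle_mean_rotate:
  fixes g :: "complex \<Rightarrow> 'a::banach"
  assumes g: "continuous_on (sphere 0 1) g" and w: "w \<in> sphere 0 1"
  shows "circle_mean (\<lambda>z. g (w * z)) = circle_mean g"
proof -
  define s where "s = Arg2pi w / (2 * pi)"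
  let ?G = "\<lambda>t. g (cis (2 * pi * t))"
  have s: "0 \<le> s" "s \<le> 1"
    using Arg2pi[of w] by (auto simp: s_def)
  have "w = cis (2 * pi * s)"
    using w complex_norm_eq_1_exp[of w] by (simp add: s_def cis_conv_exp)
  then have "circle_mean (\<lambda>z. g (w * z)) = integral {0..1} (?G \<circ> (+) s)"
    by (simp add: circle_mean_def cis_mult o_def distrib_left)
  also have "\<dots> = integral {s..1 + s} ?G"
    using integral_shift_Icc_real[of 0 1 ?G s] by simp
  also have "\<dots> = integral {s..1} ?G + integral {1..1 + s} ?G"
    by (rule Henstock_Kurzweil_Integration.integral_combine[symmetric]) (use s in \<open>auto intro: integrable_circle g\<close>)
  also have "integral {1..1 + s} ?G = integral {0..s} (?G \<circ> (+) 1)"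
    using integral_shift_Icc_real[of 0 s ?G 1] by (simp add: add.commute)
  also have "?G \<circ> (+) 1 = ?G"
    by (simp add: fun_eq_iff distrib_left flip: cis_mult)
  also have "integral {s..1} ?G + integral {0..s} ?G = integral {0..1} ?G"
    using Henstock_Kurzweil_Integration.integral_combine[of 0 s 1 ?G] s integrable_circle[OF g] by (simp add: add.commute)
  finally show ?thesis by (simp add: circle_mean_def)
qed

text \<open>
  The continuous functions all of whose Fourier coefficients vanish form a module over the
  Laurent polynomials, hence over the real polynomials in the real and imaginary part.
\<close>

definition fourier_null :: "(complex \<Rightarrow> 'a::cstar_algebra) \<Rightarrow> bool" where
  "fourier_null g \<longleftrightarrow> continuous_on (sphere 0 1) g \<and>
     (\<forall>k. circle_mean (\<lambda>z. cscale (z powi k) (g z)) = 0)"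

lemma continuous_on_cscale_powi:
  fixes g :: "complex \<Rightarrow> 'a::cstar_algebra"
  assumes "continuous_on (sphere 0 1) g"
  shows "continuous_on (sphere 0 1) (\<lambda>z. cscale (z powi k) (g z))"
  by (intro cscale.continuous_on continuous_intros assms) auto

lemma fourier_null_cong:
  assumes "\<And>z. z \<in> sphere 0 1 \<Longrightarrow> f z = g z"
  shows "fourier_null f \<longleftrightarrow> fourier_null g"
proof -
  have "continuous_on (sphere 0 1) f \<longleftrightarrow> continuous_on (sphere 0 1) g"
    by (rule continuous_on_cong) (auto simp: assms)
  moreover have "circle_mean (\<lambda>z. cscale (z powi k) (f z)) = circle_mean (\<lambda>z. cscale (z powi k) (g z))" for k
    by (rule circle_mean_cong) (simp add: assms)
  ultimately show ?thesis by (simp add: fourier_null_def)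
qed

lemma fourier_null_add:
  assumes "fourier_null f" "fourier_null g"
  shows "fourier_null (\<lambda>z. f z + g z)"
  using assms unfolding fourier_null_def
  by (simp add: cscale_add_right circle_mean_add continuous_on_cscale_powi continuous_on_add)

lemma fourier_null_monomial:
  assumes "fourier_null g"
  shows "fourier_null (\<lambda>z. cscale (c * z powi m) (g z))"
  unfolding fourier_null_def
proof (intro conjI allI)
  have g: "continuous_on (sphere 0 1) g"
    and null: "\<And>k. circle_mean (\<lambda>z. cscale (z powi k) (g z)) = 0"
    using assms by (auto simp: fourier_null_def)
  show "continuous_on (sphere 0 1) (\<lambda>z. cscale (c * z powi m) (g z))"
    by (intro cscale.continuous_on continuous_intros g) auto
  fix k
  have "circle_mean (\<lambda>z. cscale (z powi k) (cscale (c * z powi m) (g z)))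
      = circle_mean (\<lambda>z. cscale c (cscale (z powi (k + m)) (g z)))"
  proof (rule circle_mean_cong)
    fix z :: complex assume "z \<in> sphere 0 1"
    then have "z \<noteq> 0" by auto
    then show "cscale (z powi k) (cscale (c * z powi m) (g z)) = cscale c (cscale (z powi (k + m)) (g z))"
      by (simp add: cscale_cscale power_int_add mult.left_commute)
  qed
  also have "\<dots> = cscale c (circle_mean (\<lambda>z. cscale (z powi (k + m)) (g z)))"
    by (rule circle_mean_linear[OF cscale.bounded_linear_right continuous_on_cscale_powi[OF g]])
  finally show "circle_mean (\<lambda>z. cscale (z powi k) (cscale (c * z powi m) (g z))) = 0"
    by (simp add: null)
qed

text \<open>
  On the circle \<open>cnj z\<close> is \<open>z powi (- 1)\<close>, so a real linear functional restricts to
  \<open>c * z + cnj c * z powi (- 1)\<close> for a suitable \<open>c\<close>.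
\<close>

lemma fourier_null_real_polynomial:
  assumes "real_polynomial_function p" "fourier_null g"
  shows "fourier_null (\<lambda>z. p z *\<^sub>R g z)"
  using assms
proof (induction p arbitrary: g rule: real_polynomial_function.induct)
  case (linear f)
  define c where "c = Complex (f 1 / 2) (- f \<i> / 2)"
  have fz: "f z = f 1 * Re z + f \<i> * Im z" for z
  proof -
    have "z = Re z *\<^sub>R 1 + Im z *\<^sub>R \<i>" by (simp add: complex_eq_iff)
    then have "f z = f (Re z *\<^sub>R 1 + Im z *\<^sub>R \<i>)" by simp
    also have "\<dots> = Re z *\<^sub>R f 1 + Im z *\<^sub>R f \<i>"
      by (simp only: linear_add linear_scale bounded_linear.linear[OF linear.hyps])
    finally show ?thesis by (simp add: mult.commute)
  qed
  have "fourier_null (\<lambda>z. cscale (c * z powi 1) (g z) + cscale (cnj c * z powi (- 1)) (g z))"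
    by (intro fourier_null_add fourier_null_monomial linear.prems)
  moreover have "cscale (c * z powi 1) (g z) + cscale (cnj c * z powi (- 1)) (g z) = f z *\<^sub>R g z"
    if "z \<in> sphere 0 1" for z
  proof -
    have "z powi (- 1) = cnj z"
    proof -
      have "z * cnj z = 1" using that by (simp add: complex_norm_square[symmetric])
      then show ?thesis by (simp add: power_int_minus inverse_unique)
    qed
    then have "c * z powi 1 + cnj c * z powi (- 1) = complex_of_real (f z)"
      unfolding \<open>z powi (- 1) = cnj z\<close> by (simp add: complex_eq_iff c_def fz[of z])
    then show ?thesis unfolding cscale_add_left[symmetric] cscale_of_real[symmetric] by simp
  qed
  ultimately show ?case by (rule iffD1[OF fourier_null_cong, rotated])
next
  case (const c)
  then show ?case using fourier_null_monomial[of g "complex_of_real c" 0] by (simp add: cscale_of_real)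
next
  case (add f h)
  then show ?case using fourier_null_add[OF add.IH(1) add.IH(2)] by (simp add: scaleR_left_distrib)
next
  case (mult f h)
  then show ?case using mult.IH(1)[OF mult.IH(2)] by simp
qed

text \<open>
  If \<open>g 1\<close> were not zero, take a bump function \<open>b\<close> supported where \<open>g\<close> is close to \<open>g 1\<close>. By
  Stone-Weierstrass \<open>b\<close> is a uniform limit of polynomials, so the mean of \<open>b * g\<close> is zero; but
  it is close to the mean of \<open>b\<close> times \<open>g 1\<close>.
\<close>

lemma fourier_null_imp_zero:
  assumes "fourier_null g"
  shows "g 1 = 0"
proof (rule ccontr)
  assume "g 1 \<noteq> 0"
  define e where "e = norm (g 1) / 2"
  have e: "0 < e" using \<open>g 1 \<noteq> 0\<close> by (simp add: e_def)
  define b where "b = (\<lambda>z. max 0 (e - norm (g z - g 1)))"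
  have g: "continuous_on (sphere 0 1) g" using assms by (simp add: fourier_null_def)
  have b: "continuous_on (sphere 0 1) b" unfolding b_def by (intro continuous_intros g)
  have bg: "circle_mean (\<lambda>z. b z *\<^sub>R g z) = 0"
  proof -
    have "compact (g ` sphere 0 1)" by (intro compact_continuous_image g) auto
    then obtain M where "\<forall>x\<in>g ` sphere 0 1. norm x \<le> M"
      using compact_imp_bounded bounded_iff by metis
    then have M: "norm (g z) \<le> M" if "z \<in> sphere 0 1" for z using that by blast
    have M0: "0 \<le> M" using order.trans[OF norm_ge_zero M[of 1]] by simp
    have "norm (circle_mean (\<lambda>z. b z *\<^sub>R g z)) \<le> \<epsilon> * M" if "0 < \<epsilon>" for \<epsilon>
    proof -
      obtain p where p: "real_polynomial_function p" "\<And>z. z \<in> sphere 0 1 \<Longrightarrow> \<bar>b z - p z\<bar> < \<epsilon>"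
        using Stone_Weierstrass_real_polynomial_function[OF _ b \<open>0 < \<epsilon>\<close>] by auto
      have pg: "fourier_null (\<lambda>z. p z *\<^sub>R g z)" by (rule fourier_null_real_polynomial[OF p(1) assms])
      then have pg0: "circle_mean (\<lambda>z. p z *\<^sub>R g z) = 0"
        unfolding fourier_null_def by (metis (no_types, lifting) circle_mean_cong cscale_one power_int_0_right)
      have pgc: "continuous_on (sphere 0 1) (\<lambda>z. p z *\<^sub>R g z)" using pg by (simp add: fourier_null_def)
      have bgc: "continuous_on (sphere 0 1) (\<lambda>z. b z *\<^sub>R g z)" by (intro continuous_intros b g)
      have "circle_mean (\<lambda>z. b z *\<^sub>R g z) = circle_mean (\<lambda>z. b z *\<^sub>R g z - p z *\<^sub>R g z)"
        by (simp add: circle_mean_diff[OF bgc pgc] pg0)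
      also have "norm \<dots> \<le> circle_mean (\<lambda>z. \<epsilon> * M)"
      proof (rule norm_circle_mean_le)
        show "continuous_on (sphere 0 1) (\<lambda>z. b z *\<^sub>R g z - p z *\<^sub>R g z)"
          by (intro continuous_on_diff bgc pgc)
        show "norm (b z *\<^sub>R g z - p z *\<^sub>R g z) \<le> \<epsilon> * M" if "z \<in> sphere 0 1" for z
          using p(2)[OF that] M[OF that] \<open>0 < \<epsilon>\<close>
          by (simp flip: scaleR_left_diff_distrib add: mult_mono)
      qed auto
      finally show ?thesis by simp
    qed
    note small = this
    have "norm (circle_mean (\<lambda>z. b z *\<^sub>R g z)) \<le> 0"
    proof (rule field_le_epsilon)
      fix d :: real assume d: "0 < d"
      have "norm (circle_mean (\<lambda>z. b z *\<^sub>R g z)) \<le> d / (M + 1) * M"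
        using small[of "d / (M + 1)"] d M0 by simp
      also have "\<dots> \<le> d" using d M0 by (simp add: field_simps)
      finally show "norm (circle_mean (\<lambda>z. b z *\<^sub>R g z)) \<le> 0 + d" by simp
    qed
    then show ?thesis by simp
  qed
  have m: "0 < circle_mean b"
  proof -
    have cont: "continuous_on {0..1} (\<lambda>t. b (cis (2 * pi * t)))"
      by (rule continuous_on_cis_compose[OF b])
    have "circle_mean b \<noteq> 0"
      unfolding circle_mean_def using integral_eq_0_iff[OF cont] e
      by (auto simp: b_def intro!: bexI[of _ 0])
    moreover have "0 \<le> circle_mean b"
      unfolding circle_mean_def by (rule integral_nonneg[OF integrable_circle[OF b]]) (simp add: b_def)
    ultimately show ?thesis by simp
  qed
  have bc: "continuous_on (sphere 0 1) (\<lambda>z. b z *\<^sub>R g 1)"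
    and bgc: "continuous_on (sphere 0 1) (\<lambda>z. b z *\<^sub>R g z)"
    and be: "continuous_on (sphere 0 1) (\<lambda>z. b z *\<^sub>R e)"
    by (intro continuous_intros b g)+
  have "circle_mean b *\<^sub>R g 1 = circle_mean (\<lambda>z. b z *\<^sub>R g 1 - b z *\<^sub>R g z)"
    using circle_mean_diff[OF bc bgc] circle_mean_linear[OF bounded_linear_scaleR_left b, of "g 1"]
    by (simp add: bg)
  also have "norm \<dots> \<le> circle_mean (\<lambda>z. b z *\<^sub>R e)"
  proof (rule norm_circle_mean_le[OF continuous_on_diff[OF bc bgc] be])
    fix z
    have "b z = 0 \<or> norm (g 1 - g z) \<le> e" by (auto simp: b_def norm_minus_commute)
    moreover have "0 \<le> b z" by (simp add: b_def)
    ultimately show "norm (b z *\<^sub>R g 1 - b z *\<^sub>R g z) \<le> b z *\<^sub>R e"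
      by (auto simp: mult_left_mono simp flip: scaleR_right_diff_distrib)
  qed
  also have "\<dots> = circle_mean b * e"
    using circle_mean_linear[OF bounded_linear_scaleR_left b, of e] by simp
  finally have "circle_mean b * norm (g 1) \<le> circle_mean b * e" using m by simp
  then show False using m e by (simp add: e_def)
qed

section \<open>Spectral decomposition of a circle action\<close>

lemma complex_subspace_spectral_subspace:
  assumes "circle_action \<alpha>"
  shows "complex_subspace (spectral_subspace \<alpha> n)"
proof -
  have aut: "star_automorphism (\<alpha> z)" if "z \<in> sphere 0 1" for z
    using assms that by (simp add: circle_action_def)
  note lin = star_automorphism_linear[OF aut]
  have "\<alpha> z 0 = 0" if "z \<in> sphere 0 1" for z using lin(5)[OF that, of 0 0] by simp
  then show ?thesis
    using lin(1,2) unfolding complex_subspace_def spectral_subspace_def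
    by (simp add: cscale_add_right cscale_cscale mult.commute)
qed

lemma spectral_subspace_mult:
  assumes \<alpha>: "circle_action \<alpha>" and x: "x \<in> spectral_subspace \<alpha> m" and y: "y \<in> spectral_subspace \<alpha> n"
  shows "x * y \<in> spectral_subspace \<alpha> (m + n)"
  unfolding spectral_subspace_def
proof safe
  fix z :: complex assume z: "z \<in> sphere 0 1"
  then have "z \<noteq> 0" by auto
  have "star_automorphism (\<alpha> z)" using \<alpha> z by (simp add: circle_action_def)
  then have "\<alpha> z (x * y) = cscale (z powi m) x * cscale (z powi n) y"
    using x y z by (simp add: star_automorphism_linear(3) spectral_subspace_def)
  then show "\<alpha> z (x * y) = cscale (z powi (m + n)) (x * y)"
    using \<open>z \<noteq> 0\<close> by (simp add: cscale_mult_left cscale_mult_right cscale_cscale power_int_add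
        mult.commute)
qed

lemma spectral_subspace_adj:
  assumes \<alpha>: "circle_action \<alpha>" and x: "x \<in> spectral_subspace \<alpha> m"
  shows "adj x \<in> spectral_subspace \<alpha> (- m)"
  unfolding spectral_subspace_def
proof safe
  fix z :: complex assume z: "z \<in> sphere 0 1"
  have "z * cnj z = 1" using z by (simp add: complex_norm_square[symmetric])
  then have "cnj z = inverse z" by (simp add: inverse_unique)
  then have "cnj (z powi m) = z powi (- m)"
    by (simp add: power_int_minus power_int_inverse)
  moreover have "star_automorphism (\<alpha> z)" using \<alpha> z by (simp add: circle_action_def)
  ultimately show "\<alpha> z (adj x) = cscale (z powi (- m)) (adj x)"
    using x z by (simp add: star_automorphism_linear(4) spectral_subspace_def adj_cscale)
qed

text \<open>
  A point \<open>w\<close> of the circle with \<open>w powi (m - n) = - 1\<close> acts on \<open>x\<close> by two different scalars.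
\<close>

lemma spectral_subspace_disjoint:
  assumes x: "x \<in> spectral_subspace \<alpha> m" "x \<in> spectral_subspace \<alpha> n" and "m \<noteq> n"
  shows "x = 0"
proof -
  define w where "w = cis (pi / of_int (m - n))"
  have w: "w \<in> sphere 0 1" "w \<noteq> 0" by (auto simp: w_def)
  have "w powi (m - n) = - 1"
    using \<open>m \<noteq> n\<close> by (simp add: w_def cis_power_int)
  then have "w powi m \<noteq> w powi n"
    using w(2) by (auto simp: power_int_diff)
  moreover have "cscale (w powi m) x = cscale (w powi n) x"
    using x w(1) by (simp add: spectral_subspace_def)
  then have "cscale (w powi m - w powi n) x = 0" by (simp add: cscale.diff_left)
  ultimately show ?thesis by simp
qed

definition spectral_component :: "(complex \<Rightarrow> 'a::cstar_algebra \<Rightarrow> 'a) \<Rightarrow> int \<Rightarrow> 'a \<Rightarrow> 'a" where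
  "spectral_component \<alpha> n a = circle_mean (\<lambda>z. cscale (z powi (- n)) (\<alpha> z a))"

context
  fixes \<alpha> :: "complex \<Rightarrow> 'a::cstar_algebra \<Rightarrow> 'a"
  assumes \<alpha>: "circle_action \<alpha>"
begin

lemma action_aut: "z \<in> sphere 0 1 \<Longrightarrow> star_automorphism (\<alpha> z)"
  and action_cont: "continuous_on (sphere 0 1) (\<lambda>z. \<alpha> z a)"
  and action_mult: "z \<in> sphere 0 1 \<Longrightarrow> w \<in> sphere 0 1 \<Longrightarrow> \<alpha> (z * w) a = \<alpha> z (\<alpha> w a)"
  using \<alpha> by (auto simp: circle_action_def)

text \<open>
  Applying \<open>\<alpha> w\<close> to the integrand rotates its argument by \<open>w\<close> and multiplies it by \<open>w powi n\<close>.
\<close>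

lemma spectral_component_mem: "spectral_component \<alpha> n a \<in> spectral_subspace \<alpha> n"
  unfolding spectral_subspace_def
proof safe
  fix w :: complex assume w: "w \<in> sphere 0 1"
  let ?g = "\<lambda>z. cscale (z powi (- n)) (\<alpha> z a)"
  have g: "continuous_on (sphere 0 1) ?g" by (rule continuous_on_cscale_powi[OF action_cont])
  have w0: "w \<noteq> 0" using w by auto
  have "\<alpha> w (spectral_component \<alpha> n a) = circle_mean (\<lambda>z. \<alpha> w (?g z))"
    unfolding spectral_component_def
    by (rule circle_mean_linear[OF star_automorphism_bounded_linear[OF action_aut[OF w]] g, symmetric])
  also have "\<dots> = circle_mean (\<lambda>z. cscale (w powi n) (?g (w * z)))"
  proof (rule circle_mean_cong)
    fix z :: complex assume z: "z \<in> sphere 0 1"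
    have "w powi n * (w * z) powi (- n) = z powi (- n)"
      using w0 by (simp add: power_int_mult_distrib power_int_minus)
    then show "\<alpha> w (?g z) = cscale (w powi n) (?g (w * z))"
      using star_automorphism_linear(2)[OF action_aut[OF w]] action_mult[OF w z]
      by (simp add: cscale_cscale)
  qed
  also have "\<dots> = cscale (w powi n) (circle_mean (\<lambda>z. ?g (w * z)))"
  proof (rule circle_mean_linear[OF cscale.bounded_linear_right])
    show "continuous_on (sphere 0 1) (\<lambda>z. ?g (w * z))"
      by (rule continuous_on_compose2[OF g])
         (use w in \<open>auto intro!: continuous_intros simp: norm_mult\<close>)
  qed
  also have "circle_mean (\<lambda>z. ?g (w * z)) = spectral_component \<alpha> n a"
    unfolding spectral_component_def by (rule circle_mean_rotate[OF g w])
  finally show "\<alpha> w (spectral_component \<alpha> n a) = cscale (w powi n) (spectral_component \<alpha> n a)" .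
qed

lemma spectral_component_same:
  assumes "a \<in> spectral_subspace \<alpha> n"
  shows "spectral_component \<alpha> n a = a"
proof -
  have "spectral_component \<alpha> n a = circle_mean (\<lambda>_. a)"
    unfolding spectral_component_def
  proof (rule circle_mean_cong)
    fix z :: complex assume z: "z \<in> sphere 0 1"
    then have "z \<noteq> 0" by auto
    then show "cscale (z powi - n) (\<alpha> z a) = a"
      using assms z by (simp add: spectral_subspace_def cscale_cscale flip: power_int_add)
  qed
  then show ?thesis by simp
qed

lemma spectral_component_diff:
  "spectral_component \<alpha> n (a - b) = spectral_component \<alpha> n a - spectral_component \<alpha> n b"
proof -
  have "spectral_component \<alpha> n (a - b) =
      circle_mean (\<lambda>z. cscale (z powi (- n)) (\<alpha> z a) - cscale (z powi (- n)) (\<alpha> z b))"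
    unfolding spectral_component_def
    by (rule circle_mean_cong)
       (simp add: linear_diff[OF bounded_linear.linear[OF star_automorphism_bounded_linear[OF action_aut]]]
          cscale.diff_right)
  then show ?thesis
    by (simp add: circle_mean_diff continuous_on_cscale_powi action_cont spectral_component_def)
qed

text \<open>
  The integrand stays in the spectral subspace of \<open>a\<close>, hence so does the mean, which then has two
  different degrees.
\<close>

lemma spectral_component_other:
  assumes "a \<in> spectral_subspace \<alpha> m" "m \<noteq> n"
  shows "spectral_component \<alpha> n a = 0"
proof (rule spectral_subspace_disjoint[OF _ spectral_component_mem \<open>m \<noteq> n\<close>])
  show "spectral_component \<alpha> n a \<in> spectral_subspace \<alpha> m"
    unfolding spectral_subspace_def
  proof safe
    fix w :: complex assume w: "w \<in> sphere 0 1"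
    have g: "continuous_on (sphere 0 1) (\<lambda>z. cscale (z powi (- n)) (\<alpha> z a))"
      by (rule continuous_on_cscale_powi[OF action_cont])
    have "\<alpha> w (spectral_component \<alpha> n a) = circle_mean (\<lambda>z. \<alpha> w (cscale (z powi (- n)) (\<alpha> z a)))"
      unfolding spectral_component_def
      by (rule circle_mean_linear[OF star_automorphism_bounded_linear[OF action_aut[OF w]] g, symmetric])
    also have "\<dots> = circle_mean (\<lambda>z. cscale (w powi m) (cscale (z powi (- n)) (\<alpha> z a)))"
      by (rule circle_mean_cong)
         (use assms(1) w in \<open>simp add: spectral_subspace_def cscale_cscale
            star_automorphism_linear(2)[OF action_aut[OF w]] mult_ac\<close>)
    also have "\<dots> = cscale (w powi m) (spectral_component \<alpha> n a)"
      unfolding spectral_component_def by (rule circle_mean_linear[OF cscale.bounded_linear_right g])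
    finally show "\<alpha> w (spectral_component \<alpha> n a) = cscale (w powi m) (spectral_component \<alpha> n a)" .
  qed
qed

lemma eq_zero_if_components_zero:
  assumes "\<And>n. spectral_component \<alpha> n b = 0"
  shows "b = 0"
proof -
  have "circle_mean (\<lambda>z. cscale (z powi k) (\<alpha> z b)) = 0" for k
    using assms[of "- k"] by (simp add: spectral_component_def)
  then have "fourier_null (\<lambda>z. \<alpha> z b)"
    by (simp add: fourier_null_def action_cont)
  then have "\<alpha> 1 b = 0" by (rule fourier_null_imp_zero)
  moreover have "inj (\<alpha> 1)" using action_aut[of 1] by (simp add: star_automorphism_def bij_def)
  moreover have "\<alpha> 1 0 = 0" using star_automorphism_linear(5)[OF action_aut[of 1], of 0 0] by simp
  ultimately show ?thesis by (metis injD)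
qed

text \<open>
  All Fourier coefficients of the difference of the two sides vanish: those inside the spectrum by
  orthogonality, those outside because the spectral subspace is zero there.
\<close>

lemma finite_spectral_decomposition:
  assumes fin: "finite (arveson_spectrum \<alpha>)"
  shows "a = (\<Sum>n\<in>arveson_spectrum \<alpha>. spectral_component \<alpha> n a)"
proof -
  let ?S = "arveson_spectrum \<alpha>"
  have sum: "spectral_component \<alpha> k (a - (\<Sum>n\<in>F. spectral_component \<alpha> n a)) =
      (if k \<in> F then 0 else spectral_component \<alpha> k a)" if "finite F" for F k
    using that
  proof (induction F)
    case (insert n F)
    have "a - (\<Sum>n\<in>insert n F. spectral_component \<alpha> n a) =
        (a - (\<Sum>n\<in>F. spectral_component \<alpha> n a)) - spectral_component \<alpha> n a"
      using insert.hyps by (simp add: algebra_simps)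
    then have "spectral_component \<alpha> k (a - (\<Sum>n\<in>insert n F. spectral_component \<alpha> n a)) =
        spectral_component \<alpha> k (a - (\<Sum>n\<in>F. spectral_component \<alpha> n a)) -
        spectral_component \<alpha> k (spectral_component \<alpha> n a)"
      by (simp only: spectral_component_diff)
    moreover have "spectral_component \<alpha> k (spectral_component \<alpha> n a) =
        (if k = n then spectral_component \<alpha> n a else 0)"
      using spectral_component_same[OF spectral_component_mem]
        spectral_component_other[OF spectral_component_mem] by auto
    ultimately show ?case unfolding insert.IH using insert.hyps by auto
  qed simp
  have "spectral_component \<alpha> k (a - (\<Sum>n\<in>?S. spectral_component \<alpha> n a)) = 0" for k
    unfolding sum[OF fin] using spectral_component_mem[of k a] by (auto simp: arveson_spectrum_def)
  then have "a - (\<Sum>n\<in>?S. spectral_component \<alpha> n a) = 0" by (rule eq_zero_if_components_zero)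
  then show ?thesis by simp
qed

end

section \<open>Simplicity of the hereditary subalgebra\<close>

theorem proposition14:
  fixes \<alpha> :: "complex \<Rightarrow> 'a::cstar_algebra \<Rightarrow> 'a"
    and n\<^sub>0 :: int
    and I J B :: "'a set"
  assumes "circle_action \<alpha>"
    and "n\<^sub>0 > 0"
    and "arveson_spectrum \<alpha> = {- n\<^sub>0, 0, n\<^sub>0}"
    and "I = closure (subspace_product (spectral_subspace \<alpha> n\<^sub>0) (spectral_subspace \<alpha> (- n\<^sub>0)))"
    and "J = closure (subspace_product (spectral_subspace \<alpha> (- n\<^sub>0)) (spectral_subspace \<alpha> n\<^sub>0))"
    and "B = closure (subspace_product (subspace_product (I + J) UNIV) (I + J))"
    and "simple_cstar_algebra I"
  shows "simple_cstar_algebra B"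
proof -
  let ?A = "spectral_subspace \<alpha>" and ?X = "spectral_subspace \<alpha> n\<^sub>0" and ?Y = "spectral_subspace \<alpha> (- n\<^sub>0)"
  note \<alpha> = assms(1) and spec = assms(3)
  have outside: "x = 0" if "x \<in> ?A m" "m \<notin> {- n\<^sub>0, 0, n\<^sub>0}" for x m
    using that spec by (auto simp: arveson_spectrum_def)
  have XX: "x * x' = 0" if "x \<in> ?X" "x' \<in> ?X" for x x'
    by (rule outside[OF spectral_subspace_mult[OF \<alpha> that]]) (use \<open>n\<^sub>0 > 0\<close> in auto)
  have YY: "y * y' = 0" if "y \<in> ?Y" "y' \<in> ?Y" for y y'
    by (rule outside[OF spectral_subspace_mult[OF \<alpha> that]]) (use \<open>n\<^sub>0 > 0\<close> in auto)
  have XAY: "x * a * y \<in> I" if x: "x \<in> ?X" and y: "y \<in> ?Y" for x a y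
  proof -
    \<comment> \<open>the components of \<open>a\<close> of degrees \<open>- n\<^sub>0\<close> and \<open>n\<^sub>0\<close> are annihilated by \<open>y\<close> on the right and \<open>x\<close> on the left\<close>
    let ?E = "\<lambda>n. spectral_component \<alpha> n a"
    have "a = ?E (- n\<^sub>0) + (?E 0 + ?E n\<^sub>0)"
      using finite_spectral_decomposition[OF \<alpha>, of a] \<open>n\<^sub>0 > 0\<close> by (simp add: spec)
    then have "x * a * y = x * (?E (- n\<^sub>0) + (?E 0 + ?E n\<^sub>0)) * y" by (rule arg_cong)
    also have "\<dots> = x * (?E (- n\<^sub>0) * y) + ((x * ?E 0) * y + (x * ?E n\<^sub>0) * y)"
      by (simp add: distrib_left distrib_right mult.assoc)
    also have "?E (- n\<^sub>0) * y = 0" by (rule YY[OF spectral_component_mem[OF \<alpha>] y])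
    also have "x * ?E n\<^sub>0 = 0" by (rule XX[OF x spectral_component_mem[OF \<alpha>]])
    finally have eq: "x * a * y = (x * ?E 0) * y" by simp
    have "x * ?E 0 \<in> ?X"
      using spectral_subspace_mult[OF \<alpha> x spectral_component_mem[OF \<alpha>, of 0 a]] by simp
    from subsetD[OF closure_subset subspace_productI[OF this y]]
    show ?thesis unfolding eq assms(4) .
  qed
  interpret corner_bimodule ?X ?Y I J "I + J" B
  proof (unfold_locales)
    show "adj x \<in> ?Y" if "x \<in> ?X" for x by (rule spectral_subspace_adj[OF \<alpha> that])
    show "adj y \<in> ?X" if "y \<in> ?Y" for y using spectral_subspace_adj[OF \<alpha> that] by simp
  qed (use assms XAY complex_subspace_spectral_subspace[OF \<alpha>] in auto)
  show ?thesis by (rule simple_B)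
qed

end
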